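(* Let $\mathcal H$ be a complex Hilbert space, let $\mathcal L$ be a subspace lattice on $\mathcal H$, and let $\mathcal R$ be the rank-one subalgebra of $\mathrm{Alg}\,\mathcal L$. The following statements are equivalent: (1) $\mathrm{Alg}\,\mathcal L=\mathrm{Alg}\,\mathrm{Lat}\,\mathcal R$; (2) $\mathrm{Lat}\,\mathrm{Alg}\,\mathcal L=\mathrm{Lat}\,\mathcal R$; (3) $[E,E_*]\subseteq\mathrm{Lat}\,\mathrm{Alg}\,\mathcal L$ for any $E\in\mathrm{Lat}\,\mathrm{Alg}\,\mathcal L$, where $[E,E_*]=\{K\in\mathcal P: E\le K\le E_*\}$.
   Context: $\mathcal B(\mathcal H)$ is the algebra of bounded linear operators on $\mathcal H$, and $\mathcal P$ is the complete lattice of all orthogonal projections in $\mathcal B(\mathcal H)$, identified with their ranges. A subspace lattice is a complete sublattice of $\mathcal P$ containing $0$ and $I$. For $\mathcal F\subseteq\mathcal P$, $\mathrm{Alg}\,\mathcal F$ is the algebra of all $T\in\mathcal B(\mathcal H)$ leaving every element of $\mathcal F$ invariant; for $\mathcal S\subseteq\mathcal B(\mathcal H)$, $\mathrm{Lat}\,\mathcal S$ is the complete lattice of all projections invariant under every element of $\mathcal S$. The rank-one subalgebra of $\mathrm{Alg}\,\mathcal L$ is the subalgebra generated by the rank-one operators belonging to $\mathrm{Alg}\,\mathcal L$. For $E,F\in\mathrm{Lat}\,\mathrm{Alg}\,\mathcal L$: $F_-=\bigvee\{G\in\mathrm{Lat}\,\mathrm{Alg}\,\mathcal L: G\not\ge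 F\}$ and $E_*=\bigwedge\{F_-: F\in\mathrm{Lat}\,\mathrm{Alg}\,\mathcal L,\ F\not\le E\}$. An empty meet is $I$ and an empty join is $0$. *)

theory Defs
  imports "HOL-Analysis.Analysis"
begin

text \<open>
  Complex Hilbert spaces, as a type class on top of \<^class>\<open>banach\<close>, so that the real structure,
  the norm and the topology are those of the library.
\<close>

class complex_hilbert = banach +
  fixes scaleC :: "complex \<Rightarrow> 'a \<Rightarrow> 'a" (infixr \<open>*\<^sub>C\<close> 75)
    and cinner :: "'a \<Rightarrow> 'a \<Rightarrow> complex"
  assumes scaleC_add_right: "a *\<^sub>C (x + y) = a *\<^sub>C x + a *\<^sub>C y"
    and scaleC_add_left: "(a + b) *\<^sub>C x = a *\<^sub>C x + b *\<^sub>C x"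
    and scaleC_scaleC: "a *\<^sub>C (b *\<^sub>C x) = (a * b) *\<^sub>C x"
    and scaleC_of_real: "complex_of_real r *\<^sub>C x = r *\<^sub>R x"
    and cinner_add_left: "cinner (x + y) z = cinner x z + cinner y z"
    and cinner_scaleC_left: "cinner (a *\<^sub>C x) y = a * cinner x y"
    and cinner_commute: "cinner y x = cnj (cinner x y)"
    and cinner_self: "cinner x x = complex_of_real ((norm x)\<^sup>2)"

instantiation complex :: complex_hilbert
begin

definition scaleC_complex :: "complex \<Rightarrow> complex \<Rightarrow> complex"
  where "scaleC_complex a x = a * x"

definition cinner_complex :: "complex \<Rightarrow> complex \<Rightarrow> complex"
  where "cinner_complex x y = x * cnj y"

instance
proof
  show "cinner x x = complex_of_real ((norm x)\<^sup>2)" for x :: complex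
    unfolding cinner_complex_def by (rule complex_norm_square[symmetric])
qed (simp_all add: scaleC_complex_def cinner_complex_def distrib_left distrib_right mult.assoc
    scaleR_conv_of_real)

end

global_interpretation cvec: vector_space "scaleC :: complex \<Rightarrow> 'a \<Rightarrow> 'a::complex_hilbert"
  defines cspan = cvec.span and cdim = cvec.dim
proof
  show "1 *\<^sub>C x = x" for x :: 'a
    using scaleC_of_real[of 1 x] by simp
qed (simp_all add: scaleC_add_right scaleC_add_left scaleC_scaleC)

definition bounded_operators :: "('a::complex_hilbert \<Rightarrow> 'a) set"
  where "bounded_operators =
    {T. bounded_linear T \<and> (\<forall>c x. T (c *\<^sub>C x) = c *\<^sub>C T x)}"

definition orthogonal_projection :: "('a::complex_hilbert \<Rightarrow> 'a) \<Rightarrow> bool"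
  where "orthogonal_projection P \<longleftrightarrow>
    P \<in> bounded_operators \<and> P \<circ> P = P \<and> (\<forall>x y. cinner (P x) y = cinner x (P y))"

text \<open>
  Projections are identified with their ranges throughout. The order of projections is then
  inclusion, \<open>0\<close> is \<open>{0}\<close>, \<open>I\<close> is \<^term>\<open>UNIV\<close>, the meet is the intersection and the join is the
  closed linear span of the union. The empty meet is \<^term>\<open>UNIV\<close>, the empty join is \<open>{0}\<close>.
\<close>

definition projections :: "'a::complex_hilbert set set"
  where "projections = {range P |P. orthogonal_projection P}"

definition Meet :: "'a::complex_hilbert set set \<Rightarrow> 'a set"
  where "Meet S = \<Inter>S"

definition Join :: "'a::complex_hilbert set set \<Rightarrow> 'a set"
  where "Join S = closure (cspan (\<Union>S))"

definition subspace_lattice :: "'a::complex_hilbert set set \<Rightarrow> bool"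
  where "subspace_lattice L \<longleftrightarrow>
    L \<subseteq> projections \<and> {0} \<in> L \<and> UNIV \<in> L \<and> (\<forall>S\<subseteq>L. Meet S \<in> L \<and> Join S \<in> L)"

definition Alg :: "'a::complex_hilbert set set \<Rightarrow> ('a \<Rightarrow> 'a) set"
  where "Alg F = {T \<in> bounded_operators. \<forall>E\<in>F. T ` E \<subseteq> E}"

definition Lat :: "('a::complex_hilbert \<Rightarrow> 'a) set \<Rightarrow> 'a set set"
  where "Lat S = {E \<in> projections. \<forall>T\<in>S. T ` E \<subseteq> E}"

definition rank_one :: "('a::complex_hilbert \<Rightarrow> 'a) \<Rightarrow> bool"
  where "rank_one T \<longleftrightarrow> T \<in> bounded_operators \<and> cdim (range T) = 1"

text \<open>Subalgebras are neither required to be unital nor closed in any topology.\<close>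

definition subalgebra :: "('a::complex_hilbert \<Rightarrow> 'a) set \<Rightarrow> bool"
  where "subalgebra A \<longleftrightarrow>
    A \<subseteq> bounded_operators \<and> (\<lambda>x. 0) \<in> A \<and>
    (\<forall>S\<in>A. \<forall>T\<in>A. (\<lambda>x. S x + T x) \<in> A) \<and>
    (\<forall>c. \<forall>T\<in>A. (\<lambda>x. c *\<^sub>C T x) \<in> A) \<and>
    (\<forall>S\<in>A. \<forall>T\<in>A. S \<circ> T \<in> A)"

definition rank_one_subalgebra :: "'a::complex_hilbert set set \<Rightarrow> ('a \<Rightarrow> 'a) set"
  where "rank_one_subalgebra L = subalgebra hull {T \<in> Alg L. rank_one T}"

text \<open>
  In the next two definitions \<open>M\<close> is the ambient lattice in which the join and the meet are
  indexed; it will be \<^term>\<open>Lat (Alg L)\<close>.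
\<close>

definition lower :: "'a::complex_hilbert set set \<Rightarrow> 'a set \<Rightarrow> 'a set"
  where "lower M F = Join {G \<in> M. \<not> F \<subseteq> G}"

definition star :: "'a::complex_hilbert set set \<Rightarrow> 'a set \<Rightarrow> 'a set"
  where "star M E = Meet {lower M F |F. F \<in> M \<and> \<not> F \<subseteq> E}"

definition interval :: "'a::complex_hilbert set \<Rightarrow> 'a set \<Rightarrow> 'a set set"
  where "interval E F = {K \<in> projections. E \<subseteq> K \<and> K \<subseteq> F}"

end

theory Submission
  imports Defs
begin

text \<open>
  Write \<open>M = Lat (Alg L)\<close>. The equivalence of the first two conditions is a formal consequence of
  the Galois connection between \<^const>\<open>Alg\<close> and \<^const>\<open>Lat\<close>: both composites
  \<open>Alg \<circ> Lat \<circ> Alg\<close> and \<open>Lat \<circ> Alg \<circ> Lat\<close> collapse.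

  The third condition enters through the identity \<open>Lat R = (\<Union>E\<in>M. [E, E\<^sub>*])\<close>, proved in
  \<open>Lat_rank_one_subalgebra\<close>. It rests on Longstaff's description of the rank-one operators of
  \<open>Alg L\<close>: such an operator maps the whole space into some \<open>F \<in> M\<close> and kills \<open>F\<^sub>-\<close>
  (\<open>rank_one_in_Alg\<close>), and conversely every \<open>x \<mapsto> \<langle>x, e\<rangle> f\<close> with \<open>f \<in> F\<close> and
  \<open>e\<close> orthogonal to \<open>F\<^sub>-\<close> lies in \<open>Alg L\<close> (\<open>elementary_in_Alg\<close>).

  Given \<open>E \<le> K \<le> E\<^sub>*\<close>, a rank-one operator attached to \<open>F\<close> either has range in
  \<open>F \<le> E \<le> K\<close>, or \<open>F\<close> is not below \<open>E\<close> and the operator kills \<open>K \<le> E\<^sub>* \<le> F\<^sub>-\<close>; so \<open>K\<close> is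
  invariant. Given an invariant \<open>K\<close>, let \<open>E\<close> be the largest element of \<open>M\<close> below \<open>K\<close>. An
  \<open>F \<in> M\<close> not below \<open>E\<close> contains a vector \<open>f\<close> outside \<open>K\<close>, and the operators
  \<open>x \<mapsto> \<langle>x, e\<rangle> f\<close> can leave \<open>K\<close> invariant only if \<open>K\<close> is orthogonal to every \<open>e\<close> orthogonal
  to \<open>F\<^sub>-\<close>, that is, \<open>K \<le> F\<^sub>-\<close>. Hence \<open>K \<le> E\<^sub>*\<close>.

  Since \<open>E \<in> [E, E\<^sub>*]\<close>, the union of the intervals equals \<open>M\<close> precisely when each of them is
  contained in \<open>M\<close>.

  Joins, orthogonal complements and meets are handled through the projection theorem: the
  ranges of orthogonal projections are exactly the closed subspaces.
\<close>

section \<open>Inner product\<close>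

lemma cinner_add_right: "cinner x (y + z) = cinner x y + cinner x z"
  by (metis cinner_add_left cinner_commute complex_cnj_add)

lemma cinner_scaleC_right: "cinner x (a *\<^sub>C y) = cnj a * cinner x y"
  by (metis cinner_scaleC_left cinner_commute complex_cnj_mult)

lemma cinner_diff_left: "cinner (x - y) z = cinner x z - cinner y z"
  using cinner_add_left[of "x - y" y z] by simp

lemma cinner_zero_left [simp]: "cinner 0 x = 0"
  using cinner_diff_left[of 0 0 x] by simp

lemma cinner_zero_right [simp]: "cinner x 0 = 0"
  by (metis cinner_zero_left cinner_commute complex_cnj_zero)

lemma cinner_self_eq_0: "cinner x x = 0 \<longleftrightarrow> x = 0"
  by (simp add: cinner_self)

lemma norm_scaleC: "norm (a *\<^sub>C x) = cmod a * norm (x :: 'a::complex_hilbert)"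
proof -
  have "complex_of_real ((norm (a *\<^sub>C x))\<^sup>2) = (a * cnj a) * cinner x x"
    by (simp only: cinner_self[symmetric] cinner_scaleC_left cinner_scaleC_right mult_ac)
  also have "\<dots> = complex_of_real ((cmod a * norm x)\<^sup>2)"
    by (simp add: complex_norm_square[symmetric] cinner_self power_mult_distrib del: of_real_power)
  finally have "(norm (a *\<^sub>C x))\<^sup>2 = (cmod a * norm x)\<^sup>2"
    by (simp only: of_real_eq_iff)
  then show ?thesis
    by (simp add: power2_eq_iff_nonneg)
qed

lemma norm_add_square: "(norm (x + y))\<^sup>2 = (norm x)\<^sup>2 + (norm y)\<^sup>2 + 2 * Re (cinner x y)"
proof -
  have *: "(norm z)\<^sup>2 = Re (cinner z z)" for z :: 'a
    by (simp add: cinner_self del: of_real_power)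
  have "Re (cinner y x) = Re (cinner x y)"
    by (subst cinner_commute) simp
  then show ?thesis
    by (simp add: * cinner_add_left cinner_add_right)
qed

lemma pythagoras: "cinner x y = 0 \<Longrightarrow> (norm (x + y))\<^sup>2 = (norm x)\<^sup>2 + (norm y)\<^sup>2"
  by (simp add: norm_add_square)

lemma parallelogram_law:
  "(norm (x + y))\<^sup>2 + (norm (x - y))\<^sup>2 = 2 * (norm x)\<^sup>2 + 2 * (norm (y :: 'a::complex_hilbert))\<^sup>2"
proof -
  have "cinner x (- y) = - cinner x y"
    using cinner_add_right[of x y "- y"] by (simp add: eq_neg_iff_add_eq_0 add.commute)
  then show ?thesis
    using norm_add_square[of x y] norm_add_square[of x "- y"] by simp
qed

text \<open>
  One step of Gram--Schmidt; for \<open>s = 0\<close> the coefficient is \<open>0\<close> and the identity is trivial.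
\<close>

lemma orthogonal_residual:
  "cinner (z - (cinner z s / complex_of_real ((norm s)\<^sup>2)) *\<^sub>C s) s = 0"
  by (cases "s = 0") (simp_all add: cinner_diff_left cinner_scaleC_left cinner_self)

lemma norm_square_residual:
  fixes z s :: "'a::complex_hilbert"
  defines "c \<equiv> cinner z s / complex_of_real ((norm s)\<^sup>2)"
  shows "(norm z)\<^sup>2 = (norm (z - c *\<^sub>C s))\<^sup>2 + (norm (c *\<^sub>C s))\<^sup>2"
proof -
  have "cinner (z - c *\<^sub>C s) (c *\<^sub>C s) = 0"
    unfolding c_def cinner_scaleC_right orthogonal_residual by simp
  from pythagoras[OF this] show ?thesis
    by simp
qed

lemma cauchy_schwarz: "cmod (cinner x y) \<le> norm x * norm y"
proof (cases "y = 0")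
  case False
  define c where "c = cinner x y / complex_of_real ((norm y)\<^sup>2)"
  have "(norm (c *\<^sub>C y))\<^sup>2 \<le> (norm x)\<^sup>2"
    using norm_square_residual[of x y] unfolding c_def by simp
  then have "cmod c * norm y \<le> norm x"
    unfolding norm_scaleC by (simp add: power2_le_iff_abs_le)
  moreover have "cmod c = cmod (cinner x y) / (norm y)\<^sup>2"
    by (simp add: c_def norm_divide norm_power)
  then have "cmod c * norm y * norm y = cmod (cinner x y)"
    using False by (simp add: power2_eq_square)
  ultimately show ?thesis
    using mult_right_mono[of "cmod c * norm y" "norm x" "norm y"] by simp
qed simp

lemma bounded_linear_scaleC: "bounded_linear (\<lambda>x :: 'a::complex_hilbert. a *\<^sub>C x)"
proof (rule bounded_linear_intro)
  show "a *\<^sub>C r *\<^sub>R x = r *\<^sub>R a *\<^sub>C x" for r and x :: 'a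
    by (simp add: scaleC_of_real[symmetric] scaleC_scaleC mult.commute)
  show "norm (a *\<^sub>C x) \<le> norm x * cmod a" for x :: 'a
    by (simp add: norm_scaleC mult.commute)
qed (rule scaleC_add_right)

section \<open>Bounded operators and closed subspaces\<close>

abbreviation closed_subspace :: "'a::complex_hilbert set \<Rightarrow> bool"
  where "closed_subspace K \<equiv> cvec.subspace K \<and> closed K"

lemma bounded_operatorsI:
  assumes "\<And>x y. T (x + y) = T x + T y" and "\<And>c x. T (c *\<^sub>C x) = c *\<^sub>C T x"
    and "\<And>x. norm (T x) \<le> norm x * B"
  shows "T \<in> bounded_operators"
proof -
  have "T (r *\<^sub>R x) = r *\<^sub>R T x" for r x
    using assms(2)[of "complex_of_real r" x] by (simp add: scaleC_of_real)
  then show ?thesis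
    unfolding bounded_operators_def
    using assms bounded_linear_intro[of T B] by blast
qed

lemma bounded_operatorsD:
  assumes "T \<in> bounded_operators"
  shows "bounded_linear T" "T (x + y) = T x + T y" "T (c *\<^sub>C x) = c *\<^sub>C T x" "T 0 = 0"
  using assms unfolding bounded_operators_def
  by (auto simp: linear_simps linear_0 bounded_linear.linear)

lemma closed_subspace_vimage:
  assumes T: "T \<in> bounded_operators" and J: "closed_subspace J"
  shows "closed_subspace (T -` J)"
proof
  show "cvec.subspace (T -` J)"
    using J by (auto intro!: cvec.subspaceI simp: bounded_operatorsD[OF T]
        cvec.subspace_0 cvec.subspace_add cvec.subspace_scale)
  show "closed (T -` J)"
    using J bounded_operatorsD(1)[OF T] by (intro closed_vimage) (auto intro: linear_continuous_on)
qed

lemma subspace_closure: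
  assumes V: "cvec.subspace V"
  shows "cvec.subspace (closure V)"
proof (rule cvec.subspaceI)
  show "0 \<in> closure V"
    using subsetD[OF closure_subset cvec.subspace_0[OF V]] .
next
  fix x y assume "x \<in> closure V" "y \<in> closure V"
  then obtain f g where fg: "\<forall>n. f n \<in> V" "f \<longlonglongrightarrow> x" "\<forall>n. g n \<in> V" "g \<longlonglongrightarrow> y"
    unfolding closure_sequential by metis
  have "\<forall>n. f n + g n \<in> V"
    using fg(1,3) cvec.subspace_add[OF V] by simp
  then show "x + y \<in> closure V"
    unfolding closure_sequential using tendsto_add[OF fg(2,4)]
    by (intro exI[of _ "\<lambda>n. f n + g n"] conjI)
next
  fix c x assume "x \<in> closure V"
  moreover have "(\<lambda>x. c *\<^sub>C x) ` closure V \<subseteq> closure ((\<lambda>x. c *\<^sub>C x) ` V)"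
    by (rule closure_bounded_linear_image_subset[OF bounded_linear_scaleC])
  moreover have "(\<lambda>x. c *\<^sub>C x) ` V \<subseteq> V"
    using V by (auto intro: cvec.subspace_scale)
  then have "closure ((\<lambda>x. c *\<^sub>C x) ` V) \<subseteq> closure V"
    by (rule closure_mono)
  ultimately show "c *\<^sub>C x \<in> closure V"
    by blast
qed

lemma closed_subspace_Join: "closed_subspace (Join S)"
  unfolding Join_def by (simp add: subspace_closure)

lemma Join_upper: "G \<in> S \<Longrightarrow> G \<subseteq> Join S"
  unfolding Join_def
  by (meson Union_upper closure_subset cvec.span_superset subset_trans)

lemma Join_least:
  assumes "closed_subspace J" "\<And>G. G \<in> S \<Longrightarrow> G \<subseteq> J"
  shows "Join S \<subseteq> J"
  unfolding Join_def using assms by (intro closure_minimal cvec.span_minimal) auto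

section \<open>The projection theorem\<close>

text \<open>
  The points of \<open>K\<close> that are nearly as close to \<open>x\<close> as possible form nested closed sets, whose
  diameters shrink to \<open>0\<close> by the parallelogram law; completeness provides a point of least
  distance, and moving it along any \<open>s \<in> K\<close> shows that the residual is orthogonal to \<open>s\<close>.
\<close>

lemma orthogonal_decomposition:
  fixes x :: "'a::complex_hilbert"
  assumes K: "closed_subspace K"
  obtains y where "y \<in> K" "\<And>s. s \<in> K \<Longrightarrow> cinner (x - y) s = 0"
proof -
  define d where "d = infdist x K"
  have sub: "cvec.subspace K" and "closed K"
    using K by auto
  have ne: "K \<noteq> {}"
    using cvec.subspace_0[OF sub] by blast
  have d_le: "d \<le> norm (x - a)" if "a \<in> K" for a
    using infdist_le[OF that, of x] by (simp add: d_def dist_norm)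
  have d0: "d \<ge> 0"
    by (simp add: d_def infdist_nonneg)
  have d2_le: "d\<^sup>2 \<le> (norm (x - a))\<^sup>2" if "a \<in> K" for a
    using d_le[OF that] d0 by (simp add: power_mono)
  define A where "A n = {a \<in> K. (norm (x - a))\<^sup>2 \<le> d\<^sup>2 + inverse (real (Suc n))}" for n
  have "\<exists>y. \<forall>n. y \<in> A n"
  proof (rule decreasing_closed_nest[of A])
    show "closed (A n)" for n
    proof -
      have "A n = K \<inter> {a. (norm (x - a))\<^sup>2 \<le> d\<^sup>2 + inverse (real (Suc n))}"
        by (auto simp: A_def)
      moreover have "closed {a. (norm (x - a))\<^sup>2 \<le> d\<^sup>2 + inverse (real (Suc n))}"
        by (intro closed_Collect_le continuous_intros)
      ultimately show ?thesis
        using \<open>closed K\<close> by auto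
    qed
    show "A n \<noteq> {}" for n
    proof -
      have "d < sqrt (d\<^sup>2 + inverse (real (Suc n)))"
        by (intro real_less_rsqrt) simp
      then obtain a where a: "a \<in> K" "dist x a < sqrt (d\<^sup>2 + inverse (real (Suc n)))"
        unfolding d_def infdist_notempty[OF ne]
        using cInf_lessD[of "dist x ` K"] ne by blast
      then have "(norm (x - a))\<^sup>2 \<le> (sqrt (d\<^sup>2 + inverse (real (Suc n))))\<^sup>2"
        by (intro power_mono) (auto simp: dist_norm)
      then have "a \<in> A n"
        using a(1) by (simp add: A_def del: of_nat_Suc)
      then show ?thesis
        by blast
    qed
    show "A n \<subseteq> A m" if "m \<le> n" for m n
    proof -
      have "inverse (real (Suc n)) \<le> inverse (real (Suc m))"
        using that by (intro le_imp_inverse_le) auto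
      then show ?thesis
        unfolding A_def by (auto simp del: of_nat_Suc intro: order_trans)
    qed
    show "\<exists>n. \<forall>a\<in>A n. \<forall>b\<in>A n. dist a b < e" if "e > 0" for e
    proof -
      obtain n where n: "inverse (real (Suc n)) < e\<^sup>2 / 4"
        using reals_Archimedean[of "e\<^sup>2 / 4"] \<open>e > 0\<close> by auto
      have "dist a b < e" if a: "a \<in> A n" and b: "b \<in> A n" for a b
      proof -
        \<comment> \<open>The midpoint of \<open>a\<close> and \<open>b\<close> is at distance at least \<open>d\<close> from \<open>x\<close>, so the
          parallelogram law bounds the square of \<open>dist a b\<close> by \<open>4 / (n + 1)\<close>.\<close>
        define m where "m = complex_of_real (1/2) *\<^sub>C (a + b)"
        have "m \<in> K"
          using a b unfolding m_def A_def
          by (intro cvec.subspace_scale[OF sub] cvec.subspace_add[OF sub]) auto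
        have "2 *\<^sub>R m = a + b"
          unfolding m_def scaleC_of_real by simp
        then have "(x - a) + (x - b) = 2 *\<^sub>R (x - m)"
          by (simp add: scaleR_diff_right scaleR_2[of x])
        then have "(norm ((x - a) + (x - b)))\<^sup>2 = 4 * (norm (x - m))\<^sup>2"
          by (simp add: power_mult_distrib)
        moreover have "norm ((x - a) - (x - b)) = dist a b"
          by (simp add: dist_norm norm_minus_commute)
        ultimately have "(dist a b)\<^sup>2 =
            2 * (norm (x - a))\<^sup>2 + 2 * (norm (x - b))\<^sup>2 - 4 * (norm (x - m))\<^sup>2"
          using parallelogram_law[of "x - a" "x - b"] by simp
        also have "\<dots> < e\<^sup>2"
          using a b n d2_le[OF \<open>m \<in> K\<close>] by (simp add: A_def del: of_nat_Suc)
        finally show ?thesis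
          using \<open>e > 0\<close> by (simp add: power_less_imp_less_base)
      qed
      then show ?thesis
        by blast
    qed
  qed blast
  then obtain y where y: "\<And>n. y \<in> A n"
    by blast
  have "y \<in> K"
    using y[of 0] by (simp add: A_def)
  have min: "(norm (x - y))\<^sup>2 \<le> d\<^sup>2"
  proof (rule field_le_epsilon)
    fix e :: real assume "e > 0"
    then obtain n where "inverse (real (Suc n)) < e"
      using reals_Archimedean by blast
    then show "(norm (x - y))\<^sup>2 \<le> d\<^sup>2 + e"
      using y[of n] by (simp add: A_def del: of_nat_Suc)
  qed
  have "cinner (x - y) s = 0" if "s \<in> K" for s
  proof -
    define c where "c = cinner (x - y) s / complex_of_real ((norm s)\<^sup>2)"
    have "y + c *\<^sub>C s \<in> K"
      by (intro cvec.subspace_add[OF sub] cvec.subspace_scale[OF sub] that \<open>y \<in> K\<close>)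
    then have "d\<^sup>2 \<le> (norm (x - y - c *\<^sub>C s))\<^sup>2"
      using d2_le by (simp add: diff_diff_eq)
    then have "(norm (c *\<^sub>C s))\<^sup>2 \<le> 0"
      using norm_square_residual[of "x - y" s, folded c_def] min by linarith
    then have "c *\<^sub>C s = 0"
      by simp
    then show ?thesis
      using orthogonal_residual[of "x - y" s, folded c_def]
      unfolding \<open>c *\<^sub>C s = 0\<close> by simp
  qed
  with \<open>y \<in> K\<close> that show thesis
    by blast
qed

text \<open>
  A range is closed because it is the kernel of \<open>x \<mapsto> P x - x\<close>. Conversely, the component of
  \<open>x\<close> in \<open>K\<close> is unique, so it depends linearly on \<open>x\<close>, and it is bounded by Pythagoras.
\<close>

lemma projections_eq_closed_subspaces: "projections = {K. closed_subspace K}"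
proof (intro equalityI subsetI CollectI)
  fix K :: "'a set" assume "K \<in> projections"
  then obtain P where P: "P \<in> bounded_operators" "P \<circ> P = P" and K: "K = range P"
    unfolding projections_def orthogonal_projection_def by blast
  have fix_iff: "K = {x. P x = x}"
    unfolding K using P(2) by (auto simp: fun_eq_iff) (metis rangeI)
  have "cvec.subspace K"
    unfolding fix_iff by (rule cvec.subspaceI) (simp_all add: bounded_operatorsD[OF P(1)])
  moreover have "closed K"
    unfolding fix_iff using bounded_operatorsD(1)[OF P(1)]
    by (intro closed_Collect_eq) (auto intro: linear_continuous_on)
  ultimately show "closed_subspace K" ..
next
  fix K :: "'a set" assume "K \<in> {K. closed_subspace K}"
  then have K: "closed_subspace K" and sub: "cvec.subspace K"
    by auto
  define comp where "comp x y \<longleftrightarrow> y \<in> K \<and> (\<forall>s\<in>K. cinner (x - y) s = 0)" for x y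
  have unique: "y = z" if "comp x y" "comp x z" for x y z
  proof -
    have "y - z \<in> K"
      using that cvec.subspace_diff[OF sub] unfolding comp_def by blast
    moreover have "cinner (y - z) s = cinner (x - z) s - cinner (x - y) s" for s
      by (simp add: cinner_diff_left)
    ultimately have "cinner (y - z) (y - z) = 0"
      using that unfolding comp_def by simp
    then show ?thesis
      by (simp add: cinner_self_eq_0)
  qed
  have "\<exists>y. comp x y" for x
    unfolding comp_def using orthogonal_decomposition[OF K] by metis
  then obtain P where P: "\<And>x. comp x (P x)"
    by metis
  have P_in: "P x \<in> K" and P_orth: "s \<in> K \<Longrightarrow> cinner (x - P x) s = 0" for x s
    using P[of x] unfolding comp_def by blast+
  have P_fix: "P x = x" if "x \<in> K" for x
    by (rule unique[OF P]) (simp add: comp_def that)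
  have "P \<in> bounded_operators"
  proof (rule bounded_operatorsI[where B = 1])
    fix x y
    have "cinner (x + y - (P x + P y)) s = cinner (x - P x) s + cinner (y - P y) s" for s
      by (simp add: cinner_diff_left cinner_add_left)
    then show "P (x + y) = P x + P y"
      by (intro unique[OF P]) (simp add: comp_def P_in P_orth cvec.subspace_add[OF sub])
  next
    fix c x
    have "cinner (c *\<^sub>C x - c *\<^sub>C P x) s = c * cinner (x - P x) s" for s
      by (simp add: cinner_diff_left cinner_scaleC_left right_diff_distrib)
    then show "P (c *\<^sub>C x) = c *\<^sub>C P x"
      by (intro unique[OF P]) (simp add: comp_def P_in P_orth cvec.subspace_scale[OF sub])
  next
    fix x
    have "(norm (P x))\<^sup>2 \<le> (norm x)\<^sup>2"
      using pythagoras[OF P_orth[OF P_in, of x x]] by simp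
    then show "norm (P x) \<le> norm x * 1"
      by (simp add: power2_le_iff_abs_le)
  qed
  moreover have "P \<circ> P = P"
    using P_fix P_in by (auto simp: fun_eq_iff)
  moreover have "cinner (P x) y = cinner x (P y)" for x y
  proof -
    have "cinner x (P y) = cinner (P x) (P y)"
      using P_orth[OF P_in, of x y] by (simp add: cinner_diff_left)
    moreover have "cinner y (P x) = cinner (P y) (P x)"
      using P_orth[OF P_in, of y x] by (simp add: cinner_diff_left)
    ultimately show ?thesis
      by (metis cinner_commute)
  qed
  ultimately have "orthogonal_projection P"
    unfolding orthogonal_projection_def by blast
  moreover have "K = range P"
    using P_in P_fix[symmetric] by blast
  ultimately show "K \<in> projections"
    unfolding projections_def by blast
qed

text \<open>
  The residual of \<open>x\<close> modulo \<open>J\<close> serves as \<open>e\<close>. This is the form in which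
  \<open>J\<^sup>\<bottom>\<^sup>\<bottom> = J\<close> is used.
\<close>

lemma separating_vector:
  assumes "closed_subspace J" "x \<notin> J"
  obtains e where "cinner x e \<noteq> 0" "\<And>s. s \<in> J \<Longrightarrow> cinner s e = 0"
proof -
  obtain y where y: "y \<in> J" "\<And>s. s \<in> J \<Longrightarrow> cinner (x - y) s = 0"
    using orthogonal_decomposition[OF assms(1)] by blast
  have e: "cinner s (x - y) = 0" if "s \<in> J" for s
    using y(2)[OF that] by (subst cinner_commute) simp
  have "cinner x (x - y) = cinner (x - y) (x - y)"
    using e[OF y(1)] by (simp add: cinner_diff_left)
  then have "cinner x (x - y) \<noteq> 0"
    using assms(2) y(1) cinner_self_eq_0[of "x - y"] by auto
  with e that show thesis
    by blast
qed

section \<open>Invariant subspaces and rank-one operators\<close>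

lemma subalgebra_Alg:
  assumes "F \<subseteq> projections"
  shows "subalgebra (Alg F)"
proof -
  have sub: "cvec.subspace E" if "E \<in> F" for E
    using assms that unfolding projections_eq_closed_subspaces by blast
  have "(\<lambda>x. 0) \<in> bounded_operators"
    by (rule bounded_operatorsI[where B = 0]) simp_all
  moreover have "(\<lambda>x. S x + T x) \<in> bounded_operators"
    if "S \<in> bounded_operators" "T \<in> bounded_operators" for S T :: "'a \<Rightarrow> 'a"
    using that unfolding bounded_operators_def by (auto intro: bounded_linear_add simp: scaleC_add_right)
  moreover have "(\<lambda>x. c *\<^sub>C T x) \<in> bounded_operators"
    if "T \<in> bounded_operators" for c and T :: "'a \<Rightarrow> 'a"
    using that bounded_linear_compose[OF bounded_linear_scaleC] unfolding bounded_operators_def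
    by (auto simp: scaleC_scaleC mult.commute)
  moreover have "S \<circ> T \<in> bounded_operators"
    if "S \<in> bounded_operators" "T \<in> bounded_operators" for S T :: "'a \<Rightarrow> 'a"
    using that bounded_linear_compose[of S T] unfolding bounded_operators_def o_def by auto
  ultimately show ?thesis
    unfolding subalgebra_def Alg_def
    by (simp add: image_subset_iff cvec.subspace_0[OF sub] cvec.subspace_add[OF sub]
        cvec.subspace_scale[OF sub] subsetI)
qed

text \<open>
  Invariance of a family of closed subspaces passes from the rank-one operators to the algebra
  that they generate.
\<close>

lemma rank_one_subalgebra_subset:
  assumes "F \<subseteq> projections" "{T \<in> Alg L. rank_one T} \<subseteq> Alg F"
  shows "rank_one_subalgebra L \<subseteq> Alg F"
  unfolding rank_one_subalgebra_def
  by (rule hull_minimal[of _ "Alg F" subalgebra, OF assms(2) subalgebra_Alg[OF assms(1)]])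

lemma rank_one_in_rank_one_subalgebra:
  "T \<in> Alg L \<Longrightarrow> rank_one T \<Longrightarrow> T \<in> rank_one_subalgebra L"
  unfolding rank_one_subalgebra_def by (simp add: hull_inc)

lemma Alg_antimono: "F \<subseteq> G \<Longrightarrow> Alg G \<subseteq> Alg F"
  unfolding Alg_def by auto

lemma Lat_antimono: "S \<subseteq> T \<Longrightarrow> Lat T \<subseteq> Lat S"
  unfolding Lat_def by auto

lemma subset_Lat_Alg: "F \<subseteq> projections \<Longrightarrow> F \<subseteq> Lat (Alg F)"
  unfolding Alg_def Lat_def by auto

lemma subset_Alg_Lat: "S \<subseteq> bounded_operators \<Longrightarrow> S \<subseteq> Alg (Lat S)"
  unfolding Alg_def Lat_def by auto

lemma Alg_subset_bounded: "Alg F \<subseteq> bounded_operators"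
  unfolding Alg_def by auto

lemma Lat_subset_projections: "Lat S \<subseteq> projections"
  unfolding Lat_def by auto

lemma Alg_Lat_Alg: "L \<subseteq> projections \<Longrightarrow> Alg (Lat (Alg L)) = Alg L"
  by (intro equalityI Alg_antimono subset_Lat_Alg subset_Alg_Lat Alg_subset_bounded)

lemma Lat_Alg_Lat: "S \<subseteq> bounded_operators \<Longrightarrow> Lat (Alg (Lat S)) = Lat S"
  by (intro equalityI Lat_antimono subset_Lat_Alg subset_Alg_Lat Lat_subset_projections)

lemma Lat_Inter:
  assumes "S \<subseteq> Lat A"
  shows "\<Inter>S \<in> Lat A"
proof -
  have S: "cvec.subspace G" "closed G" if "G \<in> S" for G
    using assms that unfolding Lat_def projections_eq_closed_subspaces by auto
  have "T ` \<Inter>S \<subseteq> \<Inter>S" if "T \<in> A" for T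
  proof (intro image_subsetI InterI)
    fix x G assume "x \<in> \<Inter>S" "G \<in> S"
    moreover from \<open>G \<in> S\<close> have "T ` G \<subseteq> G"
      using assms that unfolding Lat_def by auto
    ultimately show "T x \<in> G"
      by auto
  qed
  moreover have "cvec.subspace (\<Inter>S)" "closed (\<Inter>S)"
    using S by (intro cvec.subspace_Inter closed_Inter ballI; simp)+
  ultimately show ?thesis
    unfolding Lat_def projections_eq_closed_subspaces by simp
qed

text \<open>
  The preimage of the join under an operator is a closed subspace, so it suffices that it contains
  each of the joined subspaces.
\<close>

lemma Lat_Join:
  assumes "A \<subseteq> bounded_operators" "S \<subseteq> Lat A"
  shows "Join S \<in> Lat A"
proof -
  have "Join S \<subseteq> T -` Join S" if T: "T \<in> A" for T
  proof (rule Join_least)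
    show "closed_subspace (T -` Join S)"
      using T assms(1) by (intro closed_subspace_vimage closed_subspace_Join) auto
    fix G assume G: "G \<in> S"
    then have "T ` G \<subseteq> G"
      using T assms(2) unfolding Lat_def by auto
    then show "G \<subseteq> T -` Join S"
      using Join_upper[OF G] by blast
  qed
  then show ?thesis
    unfolding Lat_def projections_eq_closed_subspaces
    by (simp add: closed_subspace_Join image_subset_iff_subset_vimage)
qed

lemma rank_one_range:
  assumes "rank_one T"
  obtains f where "f \<in> range T" "range T \<subseteq> cspan {f}"
proof -
  obtain B where B: "B \<subseteq> range T" "range T \<subseteq> cspan B" "card B = cdim (range T)"
    by (rule cvec.basis_exists)
  then have "card B = 1"
    using assms unfolding rank_one_def by simp
  then obtain f where f: "B = {f}"
    by (rule card_1_singletonE)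
  show thesis
    using B(1,2) unfolding f by (intro that[of f]) simp_all
qed

text \<open>
  Take for \<open>F\<close> the smallest element of the lattice containing a vector \<open>f\<close> that spans the range.
  An element \<open>G\<close> that does not contain \<open>F\<close> does not contain \<open>f\<close>, so it meets the line spanned
  by \<open>f\<close> in \<open>0\<close> only; being invariant, it is mapped into that intersection. The kernel is a closed subspace and
  therefore contains the join of all these \<open>G\<close>.
\<close>

lemma rank_one_in_Alg:
  assumes "T \<in> A" "rank_one T"
  obtains F where "F \<in> Lat A" "range T \<subseteq> F" "\<And>x. x \<in> lower (Lat A) F \<Longrightarrow> T x = 0"
proof -
  have T: "T \<in> bounded_operators"
    using assms(2) unfolding rank_one_def by blast
  obtain f where f: "f \<in> range T" "range T \<subseteq> cspan {f}"
    using rank_one_range[OF assms(2)] by blast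
  have Lat_sub: "cvec.subspace G" if "G \<in> Lat A" for G
    using that unfolding Lat_def projections_eq_closed_subspaces by blast
  define F where "F = \<Inter>{G \<in> Lat A. f \<in> G}"
  have F: "F \<in> Lat A"
    unfolding F_def by (rule Lat_Inter) blast
  have "f \<in> F"
    by (simp add: F_def)
  then have "range T \<subseteq> F"
    using f(2) cvec.span_minimal[OF _ Lat_sub[OF F], of "{f}"] by blast
  moreover have "lower (Lat A) F \<subseteq> T -` {0}"
    unfolding lower_def
  proof (rule Join_least)
    show "closed_subspace (T -` {0})"
      by (rule closed_subspace_vimage[OF T]) simp
    fix G assume "G \<in> {G \<in> Lat A. \<not> F \<subseteq> G}"
    then have G: "G \<in> Lat A" and "f \<notin> G"
      unfolding F_def by auto
    have "T x = 0" if "x \<in> G" for x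
    proof (rule ccontr)
      assume nz: "T x \<noteq> 0"
      have "T x \<in> G"
        using G that assms(1) unfolding Lat_def by blast
      obtain k where k: "T x = k *\<^sub>C f"
        using f(2) unfolding cvec.span_singleton by blast
      then have "f = inverse k *\<^sub>C T x"
        using nz by (auto simp: scaleC_scaleC)
      then show False
        using cvec.subspace_scale[OF Lat_sub[OF G] \<open>T x \<in> G\<close>] \<open>f \<notin> G\<close> by metis
    qed
    then show "G \<subseteq> T -` {0}"
      by auto
  qed
  ultimately show thesis
    using F that by blast
qed

text \<open>
  Scaling \<open>e\<close> produces every scalar as an inner product with \<open>e\<close>, so the range is the whole line
  spanned by \<open>f\<close>.
\<close>

lemma rank_one_elementary:
  fixes e f :: "'a::complex_hilbert"
  assumes "e \<noteq> 0" "f \<noteq> 0"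
  shows "rank_one (\<lambda>x. cinner x e *\<^sub>C f)"
proof -
  have "(\<lambda>x. cinner x e *\<^sub>C f) \<in> bounded_operators"
  proof (rule bounded_operatorsI[where B = "norm e * norm f"])
    show "norm (cinner x e *\<^sub>C f) \<le> norm x * (norm e * norm f)" for x
      using mult_right_mono[OF cauchy_schwarz[of x e], of "norm f"]
      by (simp add: norm_scaleC mult.assoc)
  qed (simp_all add: cinner_add_left cinner_scaleC_left scaleC_add_left scaleC_scaleC)
  moreover have "range (\<lambda>x. cinner x e *\<^sub>C f) = cspan {f}"
  proof -
    have "\<exists>x. k = cinner x e" for k
      using assms(1)
      by (intro exI[of _ "(k / cinner e e) *\<^sub>C e"]) (simp add: cinner_scaleC_left cinner_self_eq_0)
    then show ?thesis
      unfolding cvec.span_singleton by auto (metis rangeI)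
  qed
  moreover have "cdim (cspan {f}) = 1"
    using assms(2) by (simp add: cvec.dim_eq_card_independent)
  ultimately show ?thesis
    unfolding rank_one_def by simp
qed

text \<open>
  An element \<open>G\<close> of the lattice either contains \<open>F\<close>, hence the range, or lies below \<open>F\<^sub>-\<close>, where
  the operator vanishes.
\<close>

lemma elementary_in_Alg:
  assumes M: "M \<subseteq> projections" and "F \<in> M" "f \<in> F" "f \<noteq> 0" "e \<noteq> 0"
    and e: "\<And>s. s \<in> lower M F \<Longrightarrow> cinner s e = 0"
  shows "(\<lambda>x. cinner x e *\<^sub>C f) \<in> Alg M"
proof -
  have "cinner x e *\<^sub>C f \<in> G" if G: "G \<in> M" and x: "x \<in> G" for G x
  proof -
    have sub: "cvec.subspace G"
      using G M unfolding projections_eq_closed_subspaces by blast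
    show ?thesis
    proof (cases "F \<subseteq> G")
      case True
      then show ?thesis
        using cvec.subspace_scale[OF sub] \<open>f \<in> F\<close> by blast
    next
      case False
      then have "G \<subseteq> lower M F"
        unfolding lower_def using G by (intro Join_upper) blast
      then show ?thesis
        using e x cvec.subspace_0[OF sub] by auto
    qed
  qed
  moreover have "(\<lambda>x. cinner x e *\<^sub>C f) \<in> bounded_operators"
    using rank_one_elementary[OF \<open>e \<noteq> 0\<close> \<open>f \<noteq> 0\<close>] unfolding rank_one_def by blast
  ultimately show ?thesis
    unfolding Alg_def by auto
qed

section \<open>The invariant subspaces of the rank-one subalgebra\<close>

text \<open>
  The dichotomy is whether the element \<open>F\<close> attached to a rank-one operator lies below \<open>E\<close>: if so
  its range stays in \<open>K\<close>, and otherwise \<open>F\<^sub>-\<close> is one of the terms of the meet \<open>E\<^sub>*\<close>.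
\<close>

lemma interval_star_subset_Lat:
  assumes "E \<in> Lat (Alg L)"
  shows "interval E (star (Lat (Alg L)) E) \<subseteq> Lat (rank_one_subalgebra L)"
proof
  fix K assume "K \<in> interval E (star (Lat (Alg L)) E)"
  then have K: "K \<in> projections" "E \<subseteq> K" "K \<subseteq> star (Lat (Alg L)) E"
    unfolding interval_def by auto
  then have "0 \<in> K"
    unfolding projections_eq_closed_subspaces by (auto intro: cvec.subspace_0)
  have "T ` K \<subseteq> K" if T: "T \<in> Alg L" "rank_one T" for T
  proof -
    obtain F where F: "F \<in> Lat (Alg L)" "range T \<subseteq> F"
      "\<And>x. x \<in> lower (Lat (Alg L)) F \<Longrightarrow> T x = 0"
      using rank_one_in_Alg[OF T] by blast
    show ?thesis
    proof (cases "F \<subseteq> E")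
      case True
      then show ?thesis
        using F(2) K(2) by blast
    next
      case False
      then have "K \<subseteq> lower (Lat (Alg L)) F"
        using F(1) K(3) unfolding star_def Meet_def by blast
      then have "T x = 0" if "x \<in> K" for x
        using F(3) that by blast
      then show ?thesis
        using \<open>0 \<in> K\<close> by auto
    qed
  qed
  then have "rank_one_subalgebra L \<subseteq> Alg {K}"
    using K(1) by (intro rank_one_subalgebra_subset) (auto simp: Alg_def)
  then show "K \<in> Lat (rank_one_subalgebra L)"
    using K(1) unfolding Lat_def Alg_def by blast
qed

text \<open>
  It remains to find the interval of an invariant \<open>K\<close>. Its lower end is the largest element of
  the lattice inside \<open>K\<close>; if \<open>K\<close> were not below some \<open>F\<^sub>-\<close> occurring in \<open>E\<^sub>*\<close>, a rank-one operator
  of \<open>Alg L\<close> would carry a vector of \<open>K\<close> to a nonzero multiple of a vector outside \<open>K\<close>.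
\<close>

lemma Lat_rank_one_subalgebra:
  assumes L: "L \<subseteq> projections"
  shows "Lat (rank_one_subalgebra L) =
    (\<Union>E\<in>Lat (Alg L). interval E (star (Lat (Alg L)) E))"
proof (intro equalityI subsetI)
  define M where "M = Lat (Alg L)"
  have M: "M \<subseteq> projections"
    unfolding M_def by (rule Lat_subset_projections)
  fix K assume K: "K \<in> Lat (rank_one_subalgebra L)"
  then have K_proj: "K \<in> projections"
    unfolding Lat_def by blast
  then have sub: "cvec.subspace K" and K_closed: "closed_subspace K"
    unfolding projections_eq_closed_subspaces by auto
  define E where "E = Join {F \<in> M. F \<subseteq> K}"
  have "E \<in> M"
    unfolding E_def M_def by (rule Lat_Join) (auto simp: Alg_def)
  have "E \<subseteq> K"
    unfolding E_def by (rule Join_least[OF K_closed]) blast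
  have "K \<subseteq> lower M F" if F: "F \<in> M" "\<not> F \<subseteq> E" for F
  proof (rule ccontr)
    assume "\<not> K \<subseteq> lower M F"
    then obtain x where x: "x \<in> K" "x \<notin> lower M F"
      by blast
    have closed: "closed_subspace (lower M F)"
      unfolding lower_def by (rule closed_subspace_Join)
    obtain e where e: "cinner x e \<noteq> 0" "\<And>s. s \<in> lower M F \<Longrightarrow> cinner s e = 0"
      using separating_vector[OF closed x(2)] by blast
    have "\<not> F \<subseteq> K"
      using F Join_upper[of F "{F \<in> M. F \<subseteq> K}"] unfolding E_def by blast
    then obtain f where f: "f \<in> F" "f \<notin> K"
      by blast
    have "e \<noteq> 0" "f \<noteq> 0"
      using e(1) f(2) cvec.subspace_0[OF sub] by auto
    then have "(\<lambda>x. cinner x e *\<^sub>C f) \<in> Alg M"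
      by (intro elementary_in_Alg[OF M F(1) f(1)] e(2)) simp_all
    then have "(\<lambda>x. cinner x e *\<^sub>C f) \<in> rank_one_subalgebra L"
      using rank_one_elementary[OF \<open>e \<noteq> 0\<close> \<open>f \<noteq> 0\<close>] Alg_Lat_Alg[OF L]
      unfolding M_def by (intro rank_one_in_rank_one_subalgebra) simp_all
    then have "(\<lambda>x. cinner x e *\<^sub>C f) ` K \<subseteq> K"
      using K unfolding Lat_def by simp
    then have "cinner x e *\<^sub>C f \<in> K"
      using x(1) by (simp add: image_subset_iff)
    then have "inverse (cinner x e) *\<^sub>C cinner x e *\<^sub>C f \<in> K"
      by (rule cvec.subspace_scale[OF sub])
    then show False
      using e(1) f(2) by (simp add: scaleC_scaleC)
  qed
  then have "K \<subseteq> star M E"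
    unfolding star_def Meet_def by auto
  then show "K \<in> (\<Union>E\<in>Lat (Alg L). interval E (star (Lat (Alg L)) E))"
    using \<open>E \<in> M\<close> \<open>E \<subseteq> K\<close> K_proj unfolding interval_def M_def by blast
next
  fix K assume "K \<in> (\<Union>E\<in>Lat (Alg L). interval E (star (Lat (Alg L)) E))"
  then show "K \<in> Lat (rank_one_subalgebra L)"
    using interval_star_subset_Lat by blast
qed

theorem theorem3p3:
  fixes L :: "'a::complex_hilbert set set"
  assumes "subspace_lattice L"
  defines "R \<equiv> rank_one_subalgebra L"
  shows "(Alg L = Alg (Lat R) \<longleftrightarrow> Lat (Alg L) = Lat R) \<and>
    (Lat (Alg L) = Lat R \<longleftrightarrow>
      (\<forall>E\<in>Lat (Alg L). interval E (star (Lat (Alg L)) E) \<subseteq> Lat (Alg L)))"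
proof -
  have L: "L \<subseteq> projections"
    using assms(1) unfolding subspace_lattice_def by blast
  have R_Alg: "R \<subseteq> Alg L"
    unfolding R_def by (rule rank_one_subalgebra_subset[OF L]) blast
  then have "R \<subseteq> bounded_operators"
    using Alg_subset_bounded by (rule subset_trans)
  then have "Alg L = Alg (Lat R) \<longleftrightarrow> Lat (Alg L) = Lat R"
    using Alg_Lat_Alg[OF L] Lat_Alg_Lat by metis
  moreover have "Lat (Alg L) \<subseteq> Lat R"
    using R_Alg by (rule Lat_antimono)
  then have "Lat (Alg L) = Lat R \<longleftrightarrow>
      (\<forall>E\<in>Lat (Alg L). interval E (star (Lat (Alg L)) E) \<subseteq> Lat (Alg L))"
    unfolding R_def Lat_rank_one_subalgebra[OF L] by blast
  ultimately show ?thesis ..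
qed

end
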